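(* Let $\widetilde G=(I,P;E)$ be a strongly $d$-Assur graph and $p$ a generic configuration. Then for every inner vertex $v\in I$, the pinned framework obtained from $(\widetilde G,p)$ by deleting $v$ and all edges incident to it has a finite motion in which every remaining inner vertex moves.
   Context: Fix $d\ge1$. A pinned graph $\widetilde G=(I,P;E)$ has disjoint finite sets $I$ (inner) and $P$ (pinned) of vertices and a finite multiset $E$ of edges, each an unordered pair of distinct vertices with at least one endpoint in $I$. A configuration $p$ assigns $p_v\in\mathbb R^d$ to each vertex. A finite motion of a pinned framework is a continuous path $p(t)$ of configurations with $p(0)=p$, pinned vertices fixed, and all edge lengths $\|p_u(t)-p_v(t)\|$ constant; an inner vertex moves if its position is not constant. The pinned rigidity matrix $R(\widetilde G,p)$ is the $|E|\times d|I|$ matrix with one row per edge and $d$ columns per inner vertex: the row of $\{i,j\}$, $i,j\in I$, has $p_i-p_j$ in the columns of $i$, $p_j-p_i$ in the columns of $j$, zeros elsewhere; the row of $\{i,k\}$, $i\in I$, $k\in P$, has $p_i-p_k$ in the columns of $i$, zeros elsewhere. An infinitesimal motion is $U=(U_i)_{i\in I}$ with $R(\widetilde G,p)U=0$. $p$ is generic if it lies in the open dense set where this matrix attains maximum rank. $\widetilde G$ is pinned $d$-isostatic if for some (equivalently every generic) $p$, $R(\widetilde G,p)$ is square and invertible; it is $d$-Assur if additionally it has no pinned $d$-isostatic subgraph $(I',P';E')$ with $\emptyset\ne I'\subsetneq I$; it is strongly $d$-Assur if it is $d$-Assur and, at a generic $p$, for every edge $e$ the framework with $e$ removed has an infinitesimal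 motion that is nonzero at every inner vertex.
   Formalization: "Generic p" in the conclusion means a maximum-rank p at which the edge-removal condition of "strongly d-Assur" holds (a set proved open and dense), that condition being assumed only at some generic p; for all maximum-rank p the claim is then false. *)

theory Defs
  imports "HOL-Analysis.Analysis" "HOL-Library.Multiset"
begin

section \<open>Matrices indexed by finite sets\<close>

text \<open>
  A matrix is a function \<open>M r c\<close> together with a finite row index set \<open>A\<close> and a finite column
  index set \<open>B\<close>; entries outside \<open>A \<times> B\<close> are ignored.
\<close>

definition mat_rank :: "'r set \<Rightarrow> 'c::finite set \<Rightarrow> ('r \<Rightarrow> 'c \<Rightarrow> real) \<Rightarrow> nat" where
  "mat_rank A B M = dim ((\<lambda>r. (\<chi> c. if c \<in> B then M r c else 0) :: real ^ 'c) ` A)"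

definition mat_square :: "'r set \<Rightarrow> 'c set \<Rightarrow> ('r \<Rightarrow> 'c \<Rightarrow> real) \<Rightarrow> bool" where
  "mat_square A B M \<longleftrightarrow> card A = card B"

definition mat_invertible :: "'r set \<Rightarrow> 'c set \<Rightarrow> ('r \<Rightarrow> 'c \<Rightarrow> real) \<Rightarrow> bool" where
  "mat_invertible A B M \<longleftrightarrow> (\<exists>N.
     (\<forall>r\<in>A. \<forall>r'\<in>A. (\<Sum>c\<in>B. M r c * N c r') = (if r = r' then 1 else 0)) \<and>
     (\<forall>c\<in>B. \<forall>c'\<in>B. (\<Sum>r\<in>A. N c r * M r c') = (if c = c' then 1 else 0)))"


section \<open>Pinned graphs\<close>

record 'v pinned_graph =
  inner_verts :: "'v set"
  pinned_verts :: "'v set"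
  edges :: "'v set multiset"

definition wf_pinned_graph :: "'v pinned_graph \<Rightarrow> bool" where
  "wf_pinned_graph G \<longleftrightarrow> finite (inner_verts G) \<and> finite (pinned_verts G) \<and> inner_verts G \<inter> pinned_verts G = {} \<and>
     (\<forall>e\<in>#edges G. \<exists>i\<in>inner_verts G. \<exists>j\<in>inner_verts G \<union> pinned_verts G. i \<noteq> j \<and> e = {i, j})"

definition subgraph :: "'v pinned_graph \<Rightarrow> 'v pinned_graph \<Rightarrow> bool" where
  "subgraph H G \<longleftrightarrow> wf_pinned_graph H \<and>
     inner_verts H \<subseteq> inner_verts G \<and> pinned_verts H \<subseteq> pinned_verts G \<and> edges H \<subseteq># edges G"

definition delete_edge :: "'v pinned_graph \<Rightarrow> 'v set \<Rightarrow> 'v pinned_graph" where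
  "delete_edge G e = G\<lparr>edges := edges G - {#e#}\<rparr>"

definition delete_vertex :: "'v pinned_graph \<Rightarrow> 'v \<Rightarrow> 'v pinned_graph" where
  "delete_vertex G v = G\<lparr>inner_verts := inner_verts G - {v}, edges := filter_mset (\<lambda>e. v \<notin> e) (edges G)\<rparr>"


section \<open>The pinned rigidity matrix\<close>

text \<open>
  The dimension is \<open>d = CARD('d)\<close>, and a configuration is a vector \<open>p\<close> of points \<open>p $ v\<close> of
  \<open>real ^ 'd\<close>. All vertices live in a finite ambient type \<open>'v\<close>; the points at vertices
  belonging to neither \<open>inner_verts G\<close> nor \<open>pinned_verts G\<close> play no role.

  The rows are indexed by the edges counted with multiplicity: \<open>(e, n)\<close> is the \<open>n\<close>-th copy of
  \<open>e\<close>. The columns are indexed by pairs of an inner vertex and a coordinate. In the row of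
  \<open>e = {w, u}\<close> the sum below consists of the single term \<open>p $ w - p $ u\<close>.
\<close>

definition rig_rows :: "'v pinned_graph \<Rightarrow> ('v set \<times> nat) set" where
  "rig_rows G = {(e, n). n < count (edges G) e}"

definition rig_cols :: "'v pinned_graph \<Rightarrow> ('v \<times> 'd::finite) set" where
  "rig_cols G = inner_verts G \<times> UNIV"

definition rig_mat :: "real ^ 'd ^ 'v \<Rightarrow> 'v set \<times> nat \<Rightarrow> 'v \<times> 'd \<Rightarrow> real" where
  "rig_mat p = (\<lambda>(e, n) (w, k). if w \<in> e then (\<Sum>u\<in>e - {w}. (p $ w - p $ u) $ k) else 0)"

definition infinitesimal_motion ::
    "'v::finite pinned_graph \<Rightarrow> real ^ 'd::finite ^ 'v \<Rightarrow> real ^ 'd ^ 'v \<Rightarrow> bool" where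
  "infinitesimal_motion G p U \<longleftrightarrow>
     (\<forall>r\<in>rig_rows G. (\<Sum>(w, k)\<in>rig_cols G. rig_mat p r (w, k) * U $ w $ k) = 0)"

definition generic :: "'v::finite pinned_graph \<Rightarrow> real ^ 'd::finite ^ 'v \<Rightarrow> bool" where
  "generic G p \<longleftrightarrow>
     (\<forall>q :: real ^ 'd ^ 'v. mat_rank (rig_rows G) (rig_cols G) (rig_mat q)
                           \<le> mat_rank (rig_rows G) (rig_cols G) (rig_mat p))"


section \<open>Isostatic and Assur graphs\<close>

definition isostatic :: "'d::finite itself \<Rightarrow> 'v::finite pinned_graph \<Rightarrow> bool" where
  "isostatic (d :: 'd itself) G \<longleftrightarrow> (\<exists>p :: real ^ 'd ^ 'v.
     mat_square (rig_rows G) (rig_cols G) (rig_mat p) \<and>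
     mat_invertible (rig_rows G) (rig_cols G) (rig_mat p))"

definition assur :: "'d::finite itself \<Rightarrow> 'v::finite pinned_graph \<Rightarrow> bool" where
  "assur d G \<longleftrightarrow> isostatic d G \<and>
     \<not> (\<exists>H. subgraph H G \<and> inner_verts H \<noteq> {} \<and> inner_verts H \<subset> inner_verts G \<and> isostatic d H)"

text \<open>
  The generic configurations at which, whichever edge is deleted, some infinitesimal motion is
  nonzero at every inner vertex. For an isostatic graph this set may be a proper subset of the
  generic (maximum rank) configurations even when it is nonempty. For example, let \<open>d = 2\<close>,
  inner vertices \<open>x, y, w, v\<close>, pinned vertices \<open>a, b\<close> and edges
  \<open>xa, ya, vb, xy, wx, wy, vw, vx\<close>, and place \<open>w\<close> at the same point as \<open>a\<close>, with the line
  \<open>vb\<close> avoiding that point and the remaining points in general position. The matrix is then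
  invertible, but deleting \<open>vb\<close> leaves only the rotation about \<open>a\<close>, which fixes \<open>w\<close>;
  and if \<open>v\<close> is deleted instead, then \<open>w\<close> is immobile even for finite motions.
\<close>

definition strong_configs :: "'v::finite pinned_graph \<Rightarrow> (real ^ 'd::finite ^ 'v) set" where
  "strong_configs G = {p. generic G p \<and>
     (\<forall>e\<in>#edges G. \<exists>U. infinitesimal_motion (delete_edge G e) p U \<and>
                         (\<forall>w\<in>inner_verts G. U $ w \<noteq> 0))}"

text \<open>
  ``At a generic \<open>p\<close>'' is read existentially, which is the weakest hypothesis. By the example
  above, demanding the condition at every configuration of maximum rank would exclude
  standard Assur graphs.
\<close>

definition strongly_assur :: "'d::finite itself \<Rightarrow> 'v::finite pinned_graph \<Rightarrow> bool" where
  "strongly_assur (d :: 'd itself) G \<longleftrightarrow>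
     assur d G \<and> (strong_configs G :: (real ^ 'd ^ 'v) set) \<noteq> {}"


section \<open>Finite motions\<close>

definition finite_motion ::
    "'v::finite pinned_graph \<Rightarrow> real ^ 'd::finite ^ 'v \<Rightarrow> (real \<Rightarrow> real ^ 'd ^ 'v) \<Rightarrow> bool" where
  "finite_motion G p q \<longleftrightarrow> continuous_on {0..1} q \<and> q 0 = p \<and>
     (\<forall>t\<in>{0..1}. \<forall>k\<in>pinned_verts G. q t $ k = p $ k) \<and>
     (\<forall>t\<in>{0..1}. \<forall>u v. {u, v} \<in># edges G \<longrightarrow> norm (q t $ u - q t $ v) = norm (p $ u - p $ v))"

definition moves :: "(real \<Rightarrow> real ^ 'd::finite ^ 'v::finite) \<Rightarrow> 'v \<Rightarrow> bool" where
  "moves q w \<longleftrightarrow> \<not> (\<lambda>t. q t $ w) constant_on {0..1}"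

end

theory Submission
  imports Defs
begin

text \<open>
  For an isostatic graph, the generic configurations are those at which the rigidity matrix \<open>R\<close> has
  trivial kernel. There the motions after deletion of the edge \<open>e\<close> form a line, spanned by the column
  of \<open>R\<^sup>-\<^sup>1\<close> belonging to \<open>e\<close>. By Cramer's rule that column is proportional to a vector of polynomials
  in \<open>p\<close>, so the strong configurations are the nonzero set of a polynomial, which is open and, if
  nonempty, dense.

  For the finite motion, choose an edge \<open>e\<close> at \<open>v\<close>. The map sending the inner vertices to the halved
  squared edge lengths has the invertible derivative \<open>R\<close> at \<open>p\<close>, so by the inverse function theorem a
  short segment of lengths along which only the length of \<open>e\<close> varies lifts to a path of configurations.
  Its initial velocity is the motion of the graph without \<open>e\<close>, which is nonzero at every inner vertex,
  and deleting \<open>v\<close> removes the constraint \<open>e\<close>.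
\<close>

section \<open>Zero sets of polynomial functions\<close>

lemma open_polynomial_nonzero:
  fixes F :: "'a::real_normed_vector \<Rightarrow> real"
  assumes "real_polynomial_function F"
  shows "open {x. F x \<noteq> 0}"
proof -
  have "continuous_on UNIV F"
    using assms by (simp add: continuous_at_imp_continuous_on continuous_real_polymonial_function)
  then show ?thesis
    using open_Collect_neq[of F "\<lambda>_. 0"] by simp
qed

text \<open>Along the line from \<open>x\<close> to \<open>y\<close>, \<open>F\<close> is a
  univariate polynomial that is nonzero at parameter 1, so it has finitely many zeros. Small nonzero
  parameters therefore give points of the nonzero set that converge to \<open>x\<close>.\<close>

lemma dense_polynomial_nonzero:
  fixes F :: "'a::real_normed_vector \<Rightarrow> real"
  assumes F: "real_polynomial_function F" and y: "F y \<noteq> 0"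
  shows "closure {x. F x \<noteq> 0} = UNIV"
proof -
  have "x \<in> closure {x. F x \<noteq> 0}" for x
  proof -
    define l where "l = (\<lambda>t::real. x + t *\<^sub>R (y - x))"
    have "polynomial_function l"
      unfolding l_def
      by (intro polynomial_function_add polynomial_function_const polynomial_function_bounded_linear
          bounded_linear_scaleR_left)
    then have "real_polynomial_function (\<lambda>t. F (l t))"
      using real_polynomial_function_compose[OF _ F] by (simp add: o_def)
    then obtain a n where an: "(\<lambda>t. F (l t)) = (\<lambda>t. \<Sum>i\<le>n. a i * t ^ i)"
      unfolding real_polynomial_function_iff_sum by blast
    have "F (l 1) \<noteq> 0"
      using y by (simp add: l_def)
    then have "\<exists>k\<le>n. a k \<noteq> 0"
      using fun_cong[OF an, of 1] by (auto intro: ccontr simp: sum.neutral)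
    then have "finite {t. F (l t) = 0}"
      using polyfun_rootbound_finite[of n a] fun_cong[OF an] by auto
    then have "\<not> (0::real) islimpt {t. F (l t) = 0}"
      by (rule islimpt_finite)
    then have "eventually (\<lambda>t. F (l t) \<noteq> 0) (at 0)"
      by (simp add: islimpt_iff_eventually)
    moreover have "(l \<longlongrightarrow> x) (at 0)"
      unfolding l_def by (auto intro!: tendsto_eq_intros)
    ultimately show ?thesis
      by (intro Lim_in_closed_set[OF closed_closure, where F = "at (0::real)"])
        (auto elim!: eventually_mono intro: closure_subset[THEN subsetD])
  qed
  then show ?thesis by auto
qed

lemma real_polynomial_function_if:
  assumes "b \<Longrightarrow> real_polynomial_function f" "\<not> b \<Longrightarrow> real_polynomial_function g"
  shows "real_polynomial_function (\<lambda>x. if b then f x else g x)"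
  using assms by (cases b) auto

text \<open>The Leibniz formula writes the determinant as a polynomial in the entries.\<close>

lemma real_polynomial_function_det:
  fixes f :: "'a::real_normed_vector \<Rightarrow> 'n::finite \<Rightarrow> 'n \<Rightarrow> real"
  assumes "\<And>i j. real_polynomial_function (\<lambda>x. f x i j)"
  shows "real_polynomial_function (\<lambda>x. det (\<chi> i j. f x i j))"
  unfolding det_def
  by (intro real_polynomial_function_sum real_polynomial_function.intros(4)[OF
        real_polynomial_function.intros(2)] real_polynomial_function_prod finite_permutations)
    (simp_all add: assms)


section \<open>Matrices with trivial kernel\<close>

text \<open>Trivial kernel. Vectors are plain functions of which only the values on \<open>B\<close>
  matter, so no type has to match the column set.\<close>

definition mat_inj :: "'r set \<Rightarrow> 'c set \<Rightarrow> ('r \<Rightarrow> 'c \<Rightarrow> real) \<Rightarrow> bool" where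
  "mat_inj A B M \<longleftrightarrow> (\<forall>x. (\<forall>r\<in>A. (\<Sum>c\<in>B. M r c * x c) = 0) \<longrightarrow> (\<forall>c\<in>B. x c = 0))"

lemma mat_invertible_imp_mat_inj:
  assumes "finite A" "finite B" "mat_invertible A B M"
  shows "mat_inj A B M"
  unfolding mat_inj_def
proof (intro allI impI ballI)
  fix x c assume x: "\<forall>r\<in>A. (\<Sum>c\<in>B. M r c * x c) = 0" and c: "c \<in> B"
  obtain N where N: "\<forall>c\<in>B. \<forall>c'\<in>B. (\<Sum>r\<in>A. N c r * M r c') = (if c = c' then 1 else 0)"
    using assms(3) unfolding mat_invertible_def by blast
  have "x c = (\<Sum>c'\<in>B. (if c = c' then 1 else 0) * x c')"
    using c assms(2) by (simp add: if_distrib[of "\<lambda>z. z * _"] cong: if_cong)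
  also have "\<dots> = (\<Sum>c'\<in>B. (\<Sum>r\<in>A. N c r * M r c') * x c')"
    using N c by (intro sum.cong) auto
  also have "\<dots> = (\<Sum>r\<in>A. N c r * (\<Sum>c'\<in>B. M r c' * x c'))"
    unfolding sum_distrib_left sum_distrib_right by (subst sum.swap) (simp add: mult.assoc)
  also have "\<dots> = 0"
    using x by simp
  finally show "x c = 0" .
qed

text \<open>The rows span a subspace of the coordinate space \<open>W\<close> of vectors supported
  on \<open>B\<close>, whose dimension is \<open>card B\<close>. The span is all of \<open>W\<close>
  exactly when no nonzero vector of \<open>W\<close> is orthogonal to every row, that is, when the
  kernel is trivial.\<close>

lemma mat_rank_le_card: "mat_rank A B M \<le> card B"
  and mat_rank_eq_card_iff: "mat_rank A B M = card B \<longleftrightarrow> mat_inj A B M"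
  for M :: "'r \<Rightarrow> 'c::finite \<Rightarrow> real"
proof -
  define row where "row = (\<lambda>r. (\<chi> c. if c \<in> B then M r c else 0) :: real ^ 'c)"
  define W where "W = {x :: real ^ 'c. \<forall>c. c \<notin> B \<longrightarrow> x $ c = 0}"
  have W: "subspace W"
    unfolding W_def by (auto simp: subspace_def)
  have dimW: "dim W = card B"
    unfolding W_def using dim_substandard_cart[of B, where 'a = real] by (simp add: dim_vec_eq)
  have rowW: "row ` A \<subseteq> W"
    by (auto simp: W_def row_def)
  then have spanW: "span (row ` A) \<subseteq> W"
    by (simp add: W span_minimal)
  have rank: "mat_rank A B M = dim (row ` A)"
    by (simp add: mat_rank_def row_def)
  show "mat_rank A B M \<le> card B"
    using dim_subset[OF rowW] by (simp add: rank dimW)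
  have inner: "row r \<bullet> x = (\<Sum>c\<in>B. M r c * x $ c)" for r x
    by (simp add: inner_vec_def row_def if_distrib[of "\<lambda>z. z * _"] sum.If_cases cong: if_cong)
  show "mat_rank A B M = card B \<longleftrightarrow> mat_inj A B M"
  proof
    assume *: "mat_rank A B M = card B"
    have eq: "span (row ` A) = W"
      by (rule subspace_dim_equal) (use * W spanW in \<open>auto simp: rank dimW\<close>)
    show "mat_inj A B M"
      unfolding mat_inj_def
    proof (intro allI impI ballI)
      fix x c assume x: "\<forall>r\<in>A. (\<Sum>c\<in>B. M r c * x c) = 0" and c: "c \<in> B"
      define y where "y = (\<chi> c. if c \<in> B then x c else 0)"
      have "\<forall>z\<in>row ` A. orthogonal y z"
        using x by (auto simp: orthogonal_def inner_commute[of y] inner) (simp add: y_def)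
      moreover have "y \<in> span (row ` A)"
        unfolding eq by (simp add: W_def y_def)
      ultimately have "orthogonal y y"
        using orthogonal_to_span by blast
      then have "y $ c = 0"
        by (simp add: orthogonal_def)
      then show "x c = 0"
        using c by (simp add: y_def)
    qed
  next
    assume *: "mat_inj A B M"
    have "span (row ` A) = W"
    proof (rule ccontr)
      assume "span (row ` A) \<noteq> W"
      then have "span (row ` A) \<subset> span W"
        using spanW W by (metis psubsetI span_eq_iff)
      then obtain y where y: "y \<noteq> 0" "y \<in> span W" "\<And>z. z \<in> span (row ` A) \<Longrightarrow> orthogonal y z"
        using orthogonal_to_subspace_exists_gen by blast
      have "\<forall>r\<in>A. (\<Sum>c\<in>B. M r c * y $ c) = 0"
        using y(3) by (auto simp: orthogonal_def inner_commute[of y] span_base simp flip: inner)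
      then have "\<forall>c\<in>B. y $ c = 0"
        using * unfolding mat_inj_def by (auto dest: spec[of _ "\<lambda>c. y $ c"])
      moreover have "y \<in> W"
        using y(2) W by (metis span_eq_iff)
      ultimately have "y = 0"
        by (auto simp: W_def vec_eq_iff)
      then show False using y(1) by simp
    qed
    then show "mat_rank A B M = card B"
      using dim_span[of "row ` A"] by (simp add: rank dimW)
  qed
qed

text \<open>
  The identity outside \<open>B\<close> makes \<^const>\<open>det\<close> available, which needs rows and columns indexed by
  the same type.
\<close>

definition square_completion :: "('c \<Rightarrow> 'r) \<Rightarrow> 'c set \<Rightarrow> ('r \<Rightarrow> 'c \<Rightarrow> real) \<Rightarrow> real ^ 'c::finite ^ 'c" where
  "square_completion \<sigma> B M = (\<chi> i j.
     if i \<in> B then if j \<in> B then M (\<sigma> i) j else 0 else if i = j then 1 else 0)"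

lemma square_completion_mult:
  "(square_completion \<sigma> B M *v x) $ i = (if i \<in> B then (\<Sum>c\<in>B. M (\<sigma> i) c * x $ c) else x $ i)"
  by (simp add: square_completion_def matrix_vector_mult_def if_distrib[of "\<lambda>z. z * _"]
      sum.If_cases cong: if_cong)

text \<open>The identity block forces a kernel vector to vanish outside \<open>B\<close>. Since
  \<open>\<sigma>\<close> maps \<open>B\<close> onto \<open>A\<close>, the remaining equations are
  those of \<open>M\<close>.\<close>

lemma det_square_completion_iff:
  fixes \<sigma> :: "'c::finite \<Rightarrow> 'r"
  assumes "\<sigma> ` B = A"
  shows "det (square_completion \<sigma> B M) \<noteq> 0 \<longleftrightarrow> mat_inj A B M"
proof -
  let ?S = "square_completion \<sigma> B M"
  have "det ?S \<noteq> 0 \<longleftrightarrow> (\<forall>x. ?S *v x = 0 \<longrightarrow> x = 0)"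
    by (metis invertible_det_nz invertible_left_inverse matrix_left_invertible_ker)
  also have "\<dots> \<longleftrightarrow> mat_inj A B M"
  proof
    assume *: "\<forall>x. ?S *v x = 0 \<longrightarrow> x = 0"
    show "mat_inj A B M"
      unfolding mat_inj_def
    proof (intro allI impI ballI)
      fix x c assume x: "\<forall>r\<in>A. (\<Sum>c\<in>B. M r c * x c) = 0" and c: "c \<in> B"
      define y where "y = (\<chi> c. if c \<in> B then x c else 0)"
      have "?S *v y = 0"
        using x assms by (auto simp: vec_eq_iff square_completion_mult y_def)
      then have "y $ c = 0"
        using * zero_index by blast
      then show "x c = 0"
        using c by (simp add: y_def)
    qed
  next
    assume *: "mat_inj A B M"
    show "\<forall>x. ?S *v x = 0 \<longrightarrow> x = 0"
    proof (intro allI impI)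
      fix x assume x: "?S *v x = 0"
      have "\<forall>c\<in>B. (\<Sum>c'\<in>B. M (\<sigma> c) c' * x $ c') = 0"
        using x by (metis square_completion_mult zero_index)
      then have "\<forall>c\<in>B. x $ c = 0"
        using * assms unfolding mat_inj_def by (auto dest: spec[of _ "\<lambda>c. x $ c"])
      moreover have "\<forall>c. c \<notin> B \<longrightarrow> x $ c = 0"
        using x by (metis square_completion_mult zero_index)
      ultimately show "x = 0"
        by (auto simp: vec_eq_iff)
    qed
  qed
  finally show ?thesis .
qed

text \<open>Column \<open>c\<close> of the adjugate of \<open>S\<close>, given by the numerators in
  Cramer's rule. For invertible \<open>S\<close> it is \<open>det S\<close> times column
  \<open>c\<close> of the inverse, and its entries are polynomials in those of
  \<open>S\<close>.\<close>

definition cofactor_vec :: "real ^ 'c::finite ^ 'c \<Rightarrow> 'c \<Rightarrow> real ^ 'c" where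
  "cofactor_vec S c = (\<chi> k. det (\<chi> i j. if j = k then axis c 1 $ i else S $ i $ j))"

text \<open>Vectors annihilated by every row except row \<open>c\<close> are exactly the multiples
  of one polynomial vector. Cramer's rule is the case of scalar 1; scaling and injectivity of
  \<open>S\<close> give the rest.\<close>

lemma mult_eq_axis_iff:
  fixes S :: "real ^ 'c::finite ^ 'c"
  assumes "det S \<noteq> 0"
  shows "S *v x = a *\<^sub>R axis c 1 \<longleftrightarrow> x = (a / det S) *\<^sub>R cofactor_vec S c"
proof -
  have 1: "S *v y = axis c 1 \<longleftrightarrow> y = (1 / det S) *\<^sub>R cofactor_vec S c" for y
    using cramer[OF assms, of y "axis c 1"] by (simp add: cofactor_vec_def vec_eq_iff)
  have "S *v ((a / det S) *\<^sub>R cofactor_vec S c) = a *\<^sub>R axis c 1"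
    using 1[of "(1 / det S) *\<^sub>R cofactor_vec S c"]
    by (simp add: matrix_vector_mult_scaleR divide_inverse flip: scaleR_scaleR)
  moreover have "inj ((*v) S)"
    using assms by (metis invertible_det_nz inj_matrix_vector_mult)
  ultimately show ?thesis
    by (metis injD)
qed


section \<open>Generic and strong configurations\<close>

lemma finite_rig_rows: "finite (rig_rows G)"
proof (rule finite_subset)
  show "rig_rows G \<subseteq> (\<Union>e\<in>set_mset (edges G). {e} \<times> {..<count (edges G) e})"
    by (force simp: rig_rows_def count_greater_zero_iff[symmetric] simp del: count_greater_zero_iff)
qed auto

lemma infinitesimal_motion_iff:
  "infinitesimal_motion G p U \<longleftrightarrow>
     (\<forall>r\<in>rig_rows G. (\<Sum>c\<in>rig_cols G. rig_mat p r c * U $ fst c $ snd c) = 0)"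
  by (simp add: infinitesimal_motion_def split_def)

text \<open>Copies are numbered from 0, so lowering the multiplicity by one drops the highest index,
  \<open>count (edges G) e - 1\<close>.\<close>

lemma rig_rows_delete_edge:
  assumes "e \<in># edges G"
  shows "rig_rows (delete_edge G e) = rig_rows G - {(e, count (edges G) e - 1)}"
proof -
  have "count (edges G) e > 0"
    using assms by simp
  then show ?thesis
    by (auto simp: rig_rows_def delete_edge_def split: if_splits)
qed

lemma rig_cols_delete_edge: "rig_cols (delete_edge G e) = rig_cols G"
  by (simp add: rig_cols_def delete_edge_def)

text \<open>The configuration witnessing isostaticity attains full column rank. This is the largest
  rank possible, so it is the rank that every generic configuration must have.\<close>

lemma generic_iff_mat_inj:
  fixes p :: "real ^ 'd ^ 'v"
  assumes "isostatic TYPE('d::finite) (G :: 'v::finite pinned_graph)"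
  shows "generic G p \<longleftrightarrow> mat_inj (rig_rows G) (rig_cols G) (rig_mat p)"
proof -
  obtain p0 :: "real ^ 'd ^ 'v" where "mat_invertible (rig_rows G) (rig_cols G) (rig_mat p0)"
    using assms unfolding isostatic_def by blast
  then have "mat_rank (rig_rows G) (rig_cols G) (rig_mat p0) = card (rig_cols G :: ('v \<times> 'd) set)"
    by (simp add: mat_rank_eq_card_iff mat_invertible_imp_mat_inj finite_rig_rows)
  then have "generic G p \<longleftrightarrow>
      mat_rank (rig_rows G) (rig_cols G) (rig_mat p) = card (rig_cols G :: ('v \<times> 'd) set)"
    unfolding generic_def by (metis mat_rank_le_card le_antisym)
  then show ?thesis
    by (simp add: mat_rank_eq_card_iff)
qed

text \<open>Squareness allows the rows to be indexed by the columns, as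
  \<open>square_completion\<close> requires.\<close>

lemma isostatic_imp_bij:
  assumes "isostatic TYPE('d::finite) (G :: 'v::finite pinned_graph)"
  obtains \<sigma> where "bij_betw \<sigma> (rig_cols G :: ('v \<times> 'd) set) (rig_rows G)"
proof -
  have "card (rig_cols G :: ('v \<times> 'd) set) = card (rig_rows G)"
    using assms by (auto simp: isostatic_def mat_square_def)
  then show ?thesis
    using that finite_same_card_bij[OF _ finite_rig_rows] by (metis finite)
qed

text \<open>Removing the row \<open>\<sigma> c\<close> leaves a one-dimensional kernel spanned by
  \<open>cofactor_vec\<close>. Hence a motion that is nonzero at every inner vertex exists iff this
  vector has a nonzero block at every inner vertex.\<close>

lemma delete_edge_motion_iff:
  fixes p :: "real ^ 'd::finite ^ 'v::finite"
  assumes bij: "bij_betw \<sigma> (rig_cols G) (rig_rows G)"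
    and det: "det (square_completion \<sigma> (rig_cols G) (rig_mat p)) \<noteq> 0"
    and e: "e \<in># edges G" and c: "c \<in> rig_cols G" "\<sigma> c = (e, count (edges G) e - 1)"
  shows "(\<exists>U. infinitesimal_motion (delete_edge G e) p U \<and> (\<forall>w\<in>inner_verts G. U $ w \<noteq> 0)) \<longleftrightarrow>
    (\<forall>w\<in>inner_verts G. \<exists>k.
       cofactor_vec (square_completion \<sigma> (rig_cols G) (rig_mat p)) c $ (w, k) \<noteq> 0)"
    (is "?L \<longleftrightarrow> ?R")
proof -
  let ?B = "rig_cols G :: ('v \<times> 'd) set"
  let ?S = "square_completion \<sigma> ?B (rig_mat p)"
  have motion: "infinitesimal_motion (delete_edge G e) p U \<longleftrightarrow>
      (\<forall>i\<in>?B - {c}. (\<Sum>c\<in>?B. rig_mat p (\<sigma> i) c * U $ fst c $ snd c) = 0)" for U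
  proof -
    have "rig_rows (delete_edge G e) = \<sigma> ` (?B - {c})"
      using inj_on_image_set_diff[of \<sigma> ?B ?B "{c}"] bij c
      by (simp add: rig_rows_delete_edge[OF e] bij_betw_def)
    then show ?thesis
      by (simp add: infinitesimal_motion_iff rig_cols_delete_edge)
  qed
  show ?thesis
  proof
    assume ?L
    then obtain U where U: "infinitesimal_motion (delete_edge G e) p U" "\<forall>w\<in>inner_verts G. U $ w \<noteq> 0"
      by blast
    \<comment> \<open>\<open>U\<close> as a flat vector, set to zero off the inner vertices so that
      the identity rows of the completion vanish on it too.\<close>
    define x where "x = (\<chi> c. if c \<in> ?B then U $ fst c $ snd c else 0)"
    have Sx: "(?S *v x) $ i = 0" if "i \<noteq> c" for i
      using that U(1) unfolding motion by (auto simp: square_completion_mult x_def)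
    have "?S *v x = ((?S *v x) $ c) *\<^sub>R axis c 1"
      using Sx by (auto simp: vec_eq_iff axis_def)
    then have x: "x = ((?S *v x) $ c / det ?S) *\<^sub>R cofactor_vec ?S c"
      using mult_eq_axis_iff[OF det] by blast
    show ?R
    proof
      fix w assume w: "w \<in> inner_verts G"
      then obtain k where "U $ w $ k \<noteq> 0"
        using U(2) by (metis vec_eq_iff zero_index)
      then have "x $ (w, k) \<noteq> 0"
        using w by (simp add: x_def rig_cols_def)
      then have "cofactor_vec ?S c $ (w, k) \<noteq> 0"
        by (subst (asm) x) simp
      then show "\<exists>k. cofactor_vec ?S c $ (w, k) \<noteq> 0" ..
    qed
  next
    assume R: ?R
    define U :: "real ^ 'd ^ 'v" where "U = (\<chi> w k. cofactor_vec ?S c $ (w, k))"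
    \<comment> \<open>The scalar \<open>det ?S\<close> makes the cofactor vector itself the
      solution.\<close>
    have "?S *v cofactor_vec ?S c = det ?S *\<^sub>R axis c 1"
      using mult_eq_axis_iff[OF det, of "cofactor_vec ?S c" "det ?S" c] det by simp
    then have *: "(?S *v cofactor_vec ?S c) $ i = 0" if "i \<noteq> c" for i
      using that by (simp add: axis_def)
    have "infinitesimal_motion (delete_edge G e) p U"
      unfolding motion
    proof
      fix i assume "i \<in> ?B - {c}"
      then show "(\<Sum>c\<in>?B. rig_mat p (\<sigma> i) c * U $ fst c $ snd c) = 0"
        using *[of i] by (simp add: square_completion_mult U_def)
    qed
    moreover have "\<forall>w\<in>inner_verts G. U $ w \<noteq> 0"
      using R by (auto simp: U_def vec_eq_iff)
    ultimately show ?L by blast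
  qed
qed

section \<open>Strong configurations as the nonzero set of a polynomial\<close>

lemma real_polynomial_function_rig_mat:
  "real_polynomial_function (\<lambda>p :: real ^ 'd::finite ^ 'v::finite. rig_mat p r c)"
proof -
  have coord: "real_polynomial_function (\<lambda>p :: real ^ 'd ^ 'v. p $ w $ k)" for w k
    by (intro real_polynomial_function.intros(1))
      (auto intro: bounded_linear_compose[OF bounded_linear_vec_nth bounded_linear_vec_nth])
  show ?thesis
    by (cases r; cases c)
      (simp add: rig_mat_def coord real_polynomial_function_if real_polynomial_function_sum
        real_polynomial_function_diff real_polynomial_function.intros(2))
qed

lemma strong_configs_polynomial:
  assumes iso: "isostatic TYPE('d::finite) (G :: 'v::finite pinned_graph)"
  obtains F where "real_polynomial_function F"
    "(strong_configs G :: (real ^ 'd ^ 'v) set) = {p. F p \<noteq> 0}"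
proof -
  let ?B = "rig_cols G :: ('v \<times> 'd) set"
  obtain \<sigma> where \<sigma>: "bij_betw \<sigma> ?B (rig_rows G)"
    by (rule isostatic_imp_bij[OF iso])
  define S where "S = (\<lambda>p :: real ^ 'd ^ 'v. square_completion \<sigma> ?B (rig_mat p))"
  \<comment> \<open>One column for each distinct edge: the one that \<open>\<sigma>\<close> pairs
    with the copy removed by \<open>delete_edge\<close>.\<close>
  define C where "C = {c\<in>?B. \<exists>e\<in>#edges G. \<sigma> c = (e, count (edges G) e - 1)}"
  \<comment> \<open>The determinant tests genericity. Each sum of squares tests that the block at
    one inner vertex is nonzero, and the products turn these tests into a conjunction.\<close>
  define F where "F = (\<lambda>p. det (S p) *
    (\<Prod>c\<in>C. \<Prod>w\<in>inner_verts G. \<Sum>k\<in>UNIV. (cofactor_vec (S p) c $ (w, k))\<^sup>2))"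
  have S: "real_polynomial_function (\<lambda>p. S p $ i $ j)" for i j
    unfolding S_def square_completion_def vec_lambda_beta
    by (intro real_polynomial_function_if real_polynomial_function_rig_mat
        real_polynomial_function.intros(2))
  have detS: "real_polynomial_function (\<lambda>p. det (S p))"
    using real_polynomial_function_det[of "\<lambda>p i j. S p $ i $ j", OF S] by simp
  have "real_polynomial_function (\<lambda>p. if j = k then axis c 1 $ i else S p $ i $ j)" for i j k c
    by (intro real_polynomial_function_if S real_polynomial_function.intros(2))
  then have "real_polynomial_function (\<lambda>p. cofactor_vec (S p) c $ k)" for c k
    unfolding cofactor_vec_def by (simp add: real_polynomial_function_det)
  then have "real_polynomial_function F"
    unfolding F_def
    by (intro real_polynomial_function.intros(4) detS real_polynomial_function_prod
        real_polynomial_function_sum real_polynomial_function_power) auto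
  moreover have "p \<in> strong_configs G \<longleftrightarrow> F p \<noteq> 0" for p
  proof -
    have gen: "generic G p \<longleftrightarrow> det (S p) \<noteq> 0"
      unfolding S_def generic_iff_mat_inj[OF iso]
      using det_square_completion_iff \<sigma> by (metis bij_betw_def)
    have "F p \<noteq> 0 \<longleftrightarrow> det (S p) \<noteq> 0 \<and>
        (\<forall>c\<in>C. \<forall>w\<in>inner_verts G. \<exists>k. cofactor_vec (S p) c $ (w, k) \<noteq> 0)"
      by (auto simp: F_def sum_nonneg_eq_0_iff)
    also have "\<dots> \<longleftrightarrow> det (S p) \<noteq> 0 \<and>
        (\<forall>e\<in>#edges G. \<exists>U. infinitesimal_motion (delete_edge G e) p U \<and>
                         (\<forall>w\<in>inner_verts G. U $ w \<noteq> 0))"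
    \<comment> \<open>Cofactor vectors describe the motions only where the determinant is nonzero,
      so the second conjuncts are compared under the first.\<close>
    proof (rule conj_cong[OF refl])
      assume det: "det (S p) \<noteq> 0"
      have iff: "(\<exists>U. infinitesimal_motion (delete_edge G e) p U \<and> (\<forall>w\<in>inner_verts G. U $ w \<noteq> 0)) \<longleftrightarrow>
          (\<forall>w\<in>inner_verts G. \<exists>k. cofactor_vec (S p) c $ (w, k) \<noteq> 0)"
        if "e \<in># edges G" "c \<in> ?B" "\<sigma> c = (e, count (edges G) e - 1)" for e c
        using delete_edge_motion_iff[OF \<sigma> _ that] det by (simp add: S_def)
      have ex: "\<exists>c\<in>?B. \<sigma> c = (e, count (edges G) e - 1)" if "e \<in># edges G" for e
      proof -
        have "(e, count (edges G) e - 1) \<in> rig_rows G"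
          using that by (simp add: rig_rows_def)
        then show ?thesis
          using \<sigma> by (metis bij_betw_imp_surj_on imageE)
      qed
      show "(\<forall>c\<in>C. \<forall>w\<in>inner_verts G. \<exists>k. cofactor_vec (S p) c $ (w, k) \<noteq> 0) \<longleftrightarrow>
        (\<forall>e\<in>#edges G. \<exists>U. infinitesimal_motion (delete_edge G e) p U \<and>
                         (\<forall>w\<in>inner_verts G. U $ w \<noteq> 0))" (is "?L \<longleftrightarrow> ?R")
      proof
        assume ?L
        show ?R
        proof
          fix e assume e: "e \<in># edges G"
          then obtain c where "c \<in> ?B" "\<sigma> c = (e, count (edges G) e - 1)"
            using ex by blast
          then show "\<exists>U. infinitesimal_motion (delete_edge G e) p U \<and>
              (\<forall>w\<in>inner_verts G. U $ w \<noteq> 0)"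
            using iff[OF e, of c] \<open>?L\<close> e by (simp add: C_def)
        qed
      next
        assume ?R
        then show ?L
          using iff by (fastforce simp: C_def)
      qed
    qed
    finally show ?thesis
      by (simp add: strong_configs_def gen)
  qed
  ultimately show ?thesis
    using that[of F] by blast
qed


section \<open>Paths with prescribed edge lengths\<close>

text \<open>
  Each edge contributes two ordered pairs, so the value is half of the squared length, whose
  derivative is the row of the rigidity matrix.
\<close>

definition half_sq_length :: "'v set \<times> nat \<Rightarrow> real ^ 'd::finite ^ 'v::finite \<Rightarrow> real" where
  "half_sq_length r q = (\<Sum>a\<in>fst r. \<Sum>b\<in>fst r. (norm (q $ a - q $ b))\<^sup>2) / 4"

lemma half_sq_length_edge:
  "a \<noteq> b \<Longrightarrow> half_sq_length ({a, b}, n) q = (norm (q $ a - q $ b))\<^sup>2 / 2"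
  by (simp add: half_sq_length_def norm_minus_commute)

text \<open>The sum runs over the columns of all vertices, pinned ones included, as differentiation
  in the whole configuration space demands. The terms with \<open>a = b\<close> are zero, so both
  indices can range over the entire edge.\<close>

lemma sum_rig_mat:
  fixes q U :: "real ^ 'd::finite ^ 'v::finite"
  shows "(\<Sum>c\<in>UNIV. rig_mat q r c * U $ fst c $ snd c)
    = (\<Sum>a\<in>fst r. \<Sum>b\<in>fst r. (q $ a - q $ b) \<bullet> U $ a)"
proof -
  have "(\<Sum>c\<in>UNIV. rig_mat q r c * U $ fst c $ snd c)
      = (\<Sum>w\<in>UNIV. \<Sum>k\<in>UNIV. rig_mat q r (w, k) * U $ w $ k)"
    by (simp add: sum.cartesian_product split_def flip: UNIV_Times_UNIV)
  also have "\<dots> = (\<Sum>w\<in>UNIV. if w \<in> fst r then \<Sum>b\<in>fst r. (q $ w - q $ b) \<bullet> U $ w else 0)"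
  proof (rule sum.cong[OF refl])
    fix w
    have "(\<Sum>k\<in>UNIV. (\<Sum>u\<in>fst r - {w}. (q $ w - q $ u) $ k) * U $ w $ k)
        = (\<Sum>u\<in>fst r - {w}. (q $ w - q $ u) \<bullet> U $ w)"
      unfolding inner_vec_def sum_distrib_right by (subst sum.swap) simp
    also have "\<dots> = (\<Sum>u\<in>fst r. (q $ w - q $ u) \<bullet> U $ w)"
      by (rule sum.mono_neutral_left) auto
    finally show "(\<Sum>k\<in>UNIV. rig_mat q r (w, k) * U $ w $ k)
        = (if w \<in> fst r then \<Sum>b\<in>fst r. (q $ w - q $ b) \<bullet> U $ w else 0)"
      by (cases r) (simp add: rig_mat_def)
  qed
  also have "\<dots> = (\<Sum>a\<in>fst r. \<Sum>b\<in>fst r. (q $ a - q $ b) \<bullet> U $ a)"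
    by (simp add: sum.If_cases)
  finally show ?thesis .
qed

text \<open>The product rule gives a factor 2, and exchanging \<open>a\<close> and \<open>b\<close>
  in the terms with \<open>U $ b\<close> gives another; together they cancel the division by
  4.\<close>

lemma half_sq_length_has_derivative:
  fixes q :: "real ^ 'd::finite ^ 'v::finite"
  shows "(half_sq_length r has_derivative (\<lambda>U. \<Sum>c\<in>UNIV. rig_mat q r c * U $ fst c $ snd c)) (at q)"
proof -
  have nth: "((\<lambda>q. q $ a) has_derivative (\<lambda>U. U $ a)) (at q)" for a and q :: "real ^ 'd ^ 'v"
    by (rule bounded_linear_imp_has_derivative[OF bounded_linear_vec_nth])
  have "((\<lambda>q. (\<Sum>a\<in>fst r. \<Sum>b\<in>fst r. (q $ a - q $ b) \<bullet> (q $ a - q $ b)) * (1 / 4)) has_derivative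
     (\<lambda>U. (\<Sum>a\<in>fst r. \<Sum>b\<in>fst r. (q $ a - q $ b) \<bullet> (U $ a - U $ b) + (U $ a - U $ b) \<bullet> (q $ a - q $ b))
        * (1 / 4))) (at q)"
    by (intro has_derivative_mult_left has_derivative_sum has_derivative_inner has_derivative_diff nth)
  moreover have "(\<Sum>a\<in>fst r. \<Sum>b\<in>fst r. (q $ a - q $ b) \<bullet> (U $ a - U $ b) + (U $ a - U $ b) \<bullet> (q $ a - q $ b))
        * (1 / 4) = (\<Sum>a\<in>fst r. \<Sum>b\<in>fst r. (q $ a - q $ b) \<bullet> U $ a)" for U
  proof -
    let ?s = "\<Sum>a\<in>fst r. \<Sum>b\<in>fst r. (q $ a - q $ b) \<bullet> U $ a"
    have "(\<Sum>a\<in>fst r. \<Sum>b\<in>fst r. (q $ a - q $ b) \<bullet> U $ b) = - ?s"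
      by (subst sum.swap) (simp add: inner_diff_left sum_negf[symmetric])
    moreover have "(\<Sum>a\<in>fst r. \<Sum>b\<in>fst r. (q $ a - q $ b) \<bullet> (U $ a - U $ b)
          + (U $ a - U $ b) \<bullet> (q $ a - q $ b))
        = 2 * (?s - (\<Sum>a\<in>fst r. \<Sum>b\<in>fst r. (q $ a - q $ b) \<bullet> U $ b))"
      unfolding sum_subtractf[symmetric] sum_distrib_left
      by (intro sum.cong refl) (simp add: inner_diff_right inner_commute)
    ultimately show ?thesis by simp
  qed
  moreover have "half_sq_length r = (\<lambda>q :: real ^ 'd ^ 'v.
      (\<Sum>a\<in>fst r. \<Sum>b\<in>fst r. (q $ a - q $ b) \<bullet> (q $ a - q $ b)) * (1 / 4))"
    by (simp add: fun_eq_iff half_sq_length_def power2_norm_eq_inner)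
  ultimately show ?thesis
    by (simp add: sum_rig_mat)
qed

section \<open>Lifting a segment through a local diffeomorphism\<close>

lemma has_derivative_vec:
  fixes f :: "'a::real_normed_vector \<Rightarrow> 'n::finite \<Rightarrow> 'b::euclidean_space"
  assumes "\<And>i. ((\<lambda>x. f x i) has_derivative (\<lambda>x. f' x i)) (at a within S)"
  shows "((\<lambda>x. \<chi> i. f x i) has_derivative (\<lambda>x. \<chi> i. f' x i)) (at a within S)"
  unfolding has_derivative_componentwise_within[of "\<lambda>x. \<chi> i. f x i"]
  by (auto simp: Basis_vec_def inner_axis intro!: has_derivative_inner_left assms)

text \<open>An injective endomorphism in finite dimension is invertible, so the inverse function
  theorem gives a local inverse \<open>g\<close> of \<open>\<Phi>\<close>. The path is the image
  under \<open>g\<close> of a short segment from \<open>\<Phi> p\<close> in direction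
  \<open>L p u\<close>; the chain rule gives it initial velocity
  \<open>s *\<^sub>R u\<close>.\<close>

lemma lift_segment:
  fixes \<Phi> :: "'a::euclidean_space \<Rightarrow> 'a"
  assumes der: "\<And>x. (\<Phi> has_derivative L x) (at x)"
    and cont: "\<And>u. continuous_on UNIV (\<lambda>x. L x u)"
    and inj: "inj (L p)"
  obtains q :: "real \<Rightarrow> 'a" and s :: real where "s > 0" "continuous_on {0..1} q" "q 0 = p"
    "\<And>t. t \<in> {0..1} \<Longrightarrow> \<Phi> (q t) = \<Phi> p + (t * s) *\<^sub>R L p u"
    "(q has_derivative (\<lambda>t. (t * s) *\<^sub>R u)) (at 0 within {0..1})"
proof -
  have bl: "bounded_linear (L x)" for x
    using der by (rule has_derivative_bounded_linear)
  then have lin: "linear (L p)"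
    by (simp add: linear_linear)
  obtain g0 where g0: "linear g0" "g0 \<circ> L p = id"
    using linear_injective_left_inverse[OF lin inj] by blast
  have apply_L: "blinfun_apply (Blinfun (L x)) = L x" for x
    by (rule bounded_linear_Blinfun_apply[OF bl])
  have apply_g0: "blinfun_apply (Blinfun g0) = g0"
    using g0 by (intro bounded_linear_Blinfun_apply) (simp add: linear_linear)
  have der': "(\<Phi> has_derivative blinfun_apply (Blinfun (L x))) (at x)" for x
    by (simp add: apply_L der)
  have inv: "Blinfun g0 o\<^sub>L Blinfun (L p) = id_blinfun"
    using g0(2) by (intro blinfun_eqI) (simp add: apply_L apply_g0 fun_eq_iff)
  \<comment> \<open>In finite dimension pointwise continuity of the derivative gives continuity in
    operator norm.\<close>
  have cont': "continuous_on UNIV (\<lambda>x. Blinfun (L x))"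
    by (intro continuous_on_blinfun_componentwise) (simp add: apply_L cont)
  obtain U V g g' where UV: "open U" "p \<in> U" "open V" "\<Phi> p \<in> V" "homeomorphism U V \<Phi> g"
    and g': "\<And>y. y \<in> V \<Longrightarrow> (g has_derivative g' y) (at y)"
      "\<And>y. y \<in> V \<Longrightarrow> g' y = inv (blinfun_apply (Blinfun (L (g y))))"
    by (rule inverse_function_theorem[OF open_UNIV der' cont' UNIV_I inv]) metis
  have gp: "g (\<Phi> p) = p"
    using UV by (simp add: homeomorphism_apply1)
  obtain e where e: "e > 0" "ball (\<Phi> p) e \<subseteq> V"
    using UV(3,4) open_contains_ball by blast
  \<comment> \<open>Adding 1 avoids division by zero and keeps the segment strictly inside the
    ball.\<close>
  define s where "s = e / (norm (L p u) + 1)"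
  have pos: "norm (L p u) + 1 > 0"
    by (rule add_nonneg_pos) auto
  then have s: "s > 0" "s * norm (L p u) < e"
    using e(1) by (auto simp: s_def field_simps)
  define y where "y = (\<lambda>t. \<Phi> p + (t * s) *\<^sub>R L p u)"
  have y: "y t \<in> V" if "t \<in> {0..1}" for t
  proof -
    have "norm ((t * s) *\<^sub>R L p u) \<le> 1 * (s * norm (L p u))"
      using that s(1) mult_right_mono[of t 1 "s * norm (L p u)"] by (simp add: abs_mult mult.assoc)
    then have "dist (\<Phi> p) (y t) < e"
      using s(2) by (simp add: y_def dist_norm)
    then show ?thesis
      using e(2) by auto
  qed
  show ?thesis
  proof (rule that[of s "\<lambda>t. g (y t)"])
    have "continuous_on {0..1} y"
      unfolding y_def by (intro continuous_intros)
    then show "continuous_on {0..1} (\<lambda>t. g (y t))"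
      by (rule continuous_on_compose2[OF homeomorphism_cont2[OF UV(5)]]) (use y in blast)
    show "\<Phi> (g (y t)) = \<Phi> p + (t * s) *\<^sub>R L p u" if "t \<in> {0..1}" for t
      using homeomorphism_apply2[OF UV(5) y[OF that]] by (simp add: y_def)
    have "(y has_derivative (\<lambda>t. (t * s) *\<^sub>R L p u)) (at 0 within {0..1})"
      unfolding y_def by (auto intro!: derivative_eq_intros)
    moreover have "(g has_derivative inv (L p)) (at (y 0))"
      using g'(1)[OF UV(4)] g'(2)[OF UV(4)] by (simp add: y_def gp apply_L)
    ultimately have "((\<lambda>t. g (y t)) has_derivative (\<lambda>t. inv (L p) ((t * s) *\<^sub>R L p u))) (at 0 within {0..1})"
      by (rule has_derivative_compose)
    moreover have "inv (L p) ((t * s) *\<^sub>R L p u) = (t * s) *\<^sub>R u" for t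
      using inv_f_f[OF inj] by (simp flip: linear_scale[OF lin])
    ultimately show "((\<lambda>t. g (y t)) has_derivative (\<lambda>t. (t * s) *\<^sub>R u)) (at 0 within {0..1})"
      by simp
  qed (use s gp in \<open>auto simp: y_def\<close>)
qed

text \<open>A constant position would have one-sided derivative zero at 0, and that derivative is
  unique.\<close>

lemma moves_if_has_derivative:
  assumes q: "(q has_derivative (\<lambda>t. (t * s) *\<^sub>R u)) (at 0 within {0..1})"
    and "s \<noteq> 0" "u $ w \<noteq> 0"
  shows "moves q w"
  unfolding moves_def
proof
  assume "(\<lambda>t. q t $ w) constant_on {0..1}"
  then obtain c where c: "\<And>t. t \<in> {0..1} \<Longrightarrow> q t $ w = c"
    unfolding constant_on_def by blast
  have "((\<lambda>t. q t $ w) has_derivative (\<lambda>t. ((t * s) *\<^sub>R u) $ w)) (at 0 within {0..1})"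
    by (rule bounded_linear.has_derivative[OF bounded_linear_vec_nth q])
  then have "((\<lambda>t. c) has_derivative (\<lambda>t. ((t * s) *\<^sub>R u) $ w)) (at 0 within {0..1})"
    by (rule has_derivative_transform[rotated 2]) (auto simp: c)
  then have "((\<lambda>t. c) has_vector_derivative s *\<^sub>R (u $ w)) (at (0::real) within {0..1})"
    by (simp add: has_vector_derivative_def)
  moreover have "((\<lambda>t. c) has_vector_derivative 0) (at (0::real) within {0..1})"
    by simp
  moreover have "at (0::real) within {0..1} \<noteq> bot"
    by (simp add: trivial_limit_within islimpt_Icc)
  ultimately have "s *\<^sub>R (u $ w) = 0"
    by (intro vector_derivative_unique_within)
  then show False
    using assms(2,3) by simp
qed

lemma edge_release_path:
  fixes p U :: "real ^ 'd::finite ^ 'v::finite"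
  assumes \<sigma>: "bij_betw \<sigma> (rig_cols G :: ('v \<times> 'd) set) (rig_rows G)"
    and inj: "mat_inj (rig_rows G) (rig_cols G) (rig_mat p)"
    and e: "e \<in># edges G" and U: "infinitesimal_motion (delete_edge G e) p U"
  obtains q where "continuous_on {0..1} q" "q 0 = p"
    "\<And>t w. t \<in> {0..1} \<Longrightarrow> w \<notin> inner_verts G \<Longrightarrow> q t $ w = p $ w"
    "\<And>t r. t \<in> {0..1} \<Longrightarrow> r \<in> rig_rows (delete_edge G e) \<Longrightarrow> half_sq_length r (q t) = half_sq_length r p"
    "\<And>w. w \<in> inner_verts G \<Longrightarrow> U $ w \<noteq> 0 \<Longrightarrow> moves q w"
proof -
  let ?B = "rig_cols G :: ('v \<times> 'd) set"
  \<comment> \<open>The column \<open>(w, k)\<close> of an inner vertex carries the length of the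
    edge copy that \<open>\<sigma>\<close> pairs with it; other points keep their coordinates. This
    makes the length map a self-map of configuration space.\<close>
  define \<Phi> :: "real ^ 'd ^ 'v \<Rightarrow> real ^ 'd ^ 'v" where
    "\<Phi> = (\<lambda>q. \<chi> w k. if w \<in> inner_verts G then half_sq_length (\<sigma> (w, k)) q else q $ w $ k)"
  define L :: "real ^ 'd ^ 'v \<Rightarrow> real ^ 'd ^ 'v \<Rightarrow> real ^ 'd ^ 'v" where
    "L = (\<lambda>x U. \<chi> w k. if w \<in> inner_verts G
        then \<Sum>c\<in>UNIV. rig_mat x (\<sigma> (w, k)) c * U $ fst c $ snd c else U $ w $ k)"
  \<comment> \<open>On vectors supported on the inner vertices, the full derivative reduces to the
    rigidity matrix.\<close>
  have row: "(\<Sum>c\<in>UNIV. rig_mat x r c * Y $ fst c $ snd c) = (\<Sum>c\<in>?B. rig_mat x r c * Y $ fst c $ snd c)"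
    if "\<And>w. w \<notin> inner_verts G \<Longrightarrow> Y $ w = 0" for Y :: "real ^ 'd ^ 'v" and x r
  proof (rule sum.mono_neutral_right)
    have "Y $ fst c = 0" if "c \<notin> ?B" for c
      using \<open>\<And>w. w \<notin> inner_verts G \<Longrightarrow> Y $ w = 0\<close> that by (cases c) (simp add: rig_cols_def)
    then show "\<forall>c\<in>UNIV - ?B. rig_mat x r c * Y $ fst c $ snd c = 0"
      by simp
  qed auto
  have der: "(\<Phi> has_derivative L x) (at x)" for x
  proof -
    have nth: "((\<lambda>q :: real ^ 'd ^ 'v. q $ w $ k) has_derivative (\<lambda>U. U $ w $ k)) (at x)" for w k
      by (intro bounded_linear_imp_has_derivative
          bounded_linear_compose[OF bounded_linear_vec_nth bounded_linear_vec_nth])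
    have "((\<lambda>q. if w \<in> inner_verts G then half_sq_length (\<sigma> (w, k)) q else q $ w $ k) has_derivative
      (\<lambda>U. if w \<in> inner_verts G then \<Sum>c\<in>UNIV. rig_mat x (\<sigma> (w, k)) c * U $ fst c $ snd c
           else U $ w $ k)) (at x)" for w k
      by (cases "w \<in> inner_verts G") (simp_all add: half_sq_length_has_derivative nth)
    then show ?thesis
      unfolding \<Phi>_def L_def by (intro has_derivative_vec)
  qed
  have cont: "continuous_on UNIV (\<lambda>x. L x Y)" for Y
  proof -
    have rig: "continuous_on UNIV (\<lambda>x :: real ^ 'd ^ 'v. rig_mat x r c)" for r c
      by (intro continuous_at_imp_continuous_on ballI continuous_real_polymonial_function
          real_polynomial_function_rig_mat)
    have "continuous_on UNIV (\<lambda>x. if w \<in> inner_verts G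
        then \<Sum>c\<in>UNIV. rig_mat x (\<sigma> (w, k)) c * Y $ fst c $ snd c else Y $ w $ k)" for w k
      by (cases "w \<in> inner_verts G") (auto intro!: continuous_intros rig)
    then show ?thesis
      unfolding L_def by (intro continuous_on_vec_lambda)
  qed
  have lin: "linear (L x)" for x
    using der has_derivative_linear by blast
  have "Y = 0" if "L p Y = 0" for Y
  proof -
    have Y: "Y $ w = 0" if "w \<notin> inner_verts G" for w
      using \<open>L p Y = 0\<close> that by (auto simp: L_def vec_eq_iff dest: spec[of _ w])
    have "(\<Sum>c\<in>?B. rig_mat p (\<sigma> (w, k)) c * Y $ fst c $ snd c) = 0" if "w \<in> inner_verts G" for w k
    proof -
      have "L p Y $ w $ k = 0"
        using \<open>L p Y = 0\<close> by simp
      then show ?thesis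
        using that by (simp add: L_def row[OF Y])
    qed
    then have "\<forall>r\<in>rig_rows G. (\<Sum>c\<in>?B. rig_mat p r c * Y $ fst c $ snd c) = 0"
      unfolding bij_betw_imp_surj_on[OF \<sigma>, symmetric] by (auto simp: rig_cols_def)
    then have "\<forall>c\<in>?B. Y $ fst c $ snd c = 0"
      using inj unfolding mat_inj_def by (auto dest: spec[of _ "\<lambda>c. Y $ fst c $ snd c"])
    then show "Y = 0"
      using Y by (auto simp: vec_eq_iff rig_cols_def)
  qed
  then have "inj (L p)"
    using lin by (simp add: linear_injective_0)
  \<comment> \<open>Truncation makes \<open>L p u\<close> vanish at all non-inner vertices, so the
    lifted path fixes them. The only coordinate of \<open>L p u\<close> that may be nonzero belongs
    to the released copy of \<open>e\<close>.\<close>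
  define u where "u = (\<chi> w. if w \<in> inner_verts G then U $ w else 0)"
  have u: "w \<notin> inner_verts G \<Longrightarrow> u $ w = 0" for w
    by (simp add: u_def)
  have Lu_row: "L p u $ w $ k = 0" if "w \<in> inner_verts G" "\<sigma> (w, k) \<in> rig_rows (delete_edge G e)" for w k
  proof -
    have "(\<Sum>c\<in>?B. rig_mat p (\<sigma> (w, k)) c * u $ fst c $ snd c)
        = (\<Sum>c\<in>?B. rig_mat p (\<sigma> (w, k)) c * U $ fst c $ snd c)"
      by (intro sum.cong) (auto simp: u_def rig_cols_def)
    also have "\<dots> = 0"
      using U that(2) by (simp add: infinitesimal_motion_iff rig_cols_delete_edge)
    finally show ?thesis
      using that(1) by (simp add: L_def row[OF u])
  qed
  obtain q s where q: "s > 0" "continuous_on {0..1} q" "q 0 = p"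
    "\<And>t. t \<in> {0..1} \<Longrightarrow> \<Phi> (q t) = \<Phi> p + (t * s) *\<^sub>R L p u"
    "(q has_derivative (\<lambda>t. (t * s) *\<^sub>R u)) (at 0 within {0..1})"
    using lift_segment[OF der cont \<open>inj (L p)\<close>] by blast
  show ?thesis
  proof (rule that[of q])
    fix t :: real assume t: "t \<in> {0..1}"
    show "q t $ w = p $ w" if "w \<notin> inner_verts G" for w
    proof -
      have "\<Phi> (q t) $ w $ k = \<Phi> p $ w $ k" for k
        using that by (simp add: q(4)[OF t] L_def u)
      then show ?thesis
        using that by (simp add: \<Phi>_def vec_eq_iff)
    qed
    show "half_sq_length r (q t) = half_sq_length r p" if "r \<in> rig_rows (delete_edge G e)" for r
    proof -
      have "r \<in> rig_rows G"
        using that by (simp add: rig_rows_delete_edge[OF e])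
      then obtain w k where wk: "w \<in> inner_verts G" "\<sigma> (w, k) = r"
        using bij_betw_imp_surj_on[OF \<sigma>] by (force simp: rig_cols_def)
      have "\<Phi> (q t) $ w $ k = \<Phi> p $ w $ k"
        using Lu_row[OF wk(1)] wk(2) that by (simp add: q(4)[OF t])
      then show ?thesis
        using wk by (simp add: \<Phi>_def)
    qed
  next
    show "moves q w" if "w \<in> inner_verts G" "U $ w \<noteq> 0" for w
      using moves_if_has_derivative[OF q(5)] q(1) that by (simp add: u_def)
  qed (use q in auto)
qed

section \<open>Deleting an inner vertex\<close>

text \<open>Without an edge at \<open>v\<close> the columns of \<open>v\<close> are zero, and their
  indicator vector is a nonzero kernel element.\<close>

lemma inner_vertex_has_edge:
  fixes p :: "real ^ 'd::finite ^ 'v::finite"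
  assumes "mat_inj (rig_rows G) (rig_cols G) (rig_mat p)" "v \<in> inner_verts G"
  shows "\<exists>e\<in>#edges G. v \<in> e"
proof (rule ccontr)
  assume *: "\<not> ?thesis"
  have no: "rig_mat p r (v, k) = 0" if "r \<in> rig_rows G" for r k
  proof -
    have "fst r \<in># edges G"
      using that by (auto simp: rig_rows_def simp flip: count_greater_zero_iff)
    then have "v \<notin> fst r"
      using * by blast
    then show ?thesis
      by (cases r) (simp add: rig_mat_def)
  qed
  define x where "x = (\<lambda>c :: 'v \<times> 'd. if fst c = v then 1 else 0 :: real)"
  have "rig_mat p r c * x c = 0" if "r \<in> rig_rows G" for r c
    using no[OF that, of "snd c"] by (cases c) (simp add: x_def)
  then have "\<forall>r\<in>rig_rows G. (\<Sum>c\<in>rig_cols G. rig_mat p r c * x c) = 0"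
    by (intro ballI sum.neutral) blast
  then have "\<forall>c\<in>rig_cols G. x c = 0"
    using assms(1) unfolding mat_inj_def by blast
  then show False
    using assms(2) by (auto simp: rig_cols_def x_def)
qed

text \<open>The generic configurations of the conclusion are those in \<open>strong_configs\<close>,
  shown to be open and dense. By the example given at that definition, maximum rank alone would not
  suffice.\<close>

theorem theorem4p6:
  fixes G :: "'v::finite pinned_graph"
  assumes "wf_pinned_graph G"
    and "strongly_assur TYPE('d::finite) G"
  shows "open (strong_configs G :: (real ^ 'd ^ 'v) set) \<and>
    closure (strong_configs G :: (real ^ 'd ^ 'v) set) = UNIV \<and>
    (\<forall>p \<in> (strong_configs G :: (real ^ 'd ^ 'v) set). \<forall>v \<in> inner_verts G.
       \<exists>q. finite_motion (delete_vertex G v) p q \<and>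
           (\<forall>w \<in> inner_verts (delete_vertex G v). moves q w))"
proof -
  have iso: "isostatic TYPE('d) G" and ne: "(strong_configs G :: (real ^ 'd ^ 'v) set) \<noteq> {}"
    using assms(2) by (auto simp: strongly_assur_def assur_def)
  obtain F where F: "real_polynomial_function F"
    "(strong_configs G :: (real ^ 'd ^ 'v) set) = {p. F p \<noteq> 0}"
    by (rule strong_configs_polynomial[OF iso])
  obtain \<sigma> where \<sigma>: "bij_betw \<sigma> (rig_cols G :: ('v \<times> 'd) set) (rig_rows G)"
    by (rule isostatic_imp_bij[OF iso])
  have "\<exists>q. finite_motion (delete_vertex G v) p q \<and>
      (\<forall>w \<in> inner_verts (delete_vertex G v). moves q w)"
    if p: "p \<in> strong_configs G" and v: "v \<in> inner_verts G" for p :: "real ^ 'd ^ 'v" and v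
  proof -
    have inj: "mat_inj (rig_rows G) (rig_cols G) (rig_mat p)"
      using p by (simp add: strong_configs_def generic_iff_mat_inj[OF iso])
    obtain e where e: "e \<in># edges G" "v \<in> e"
      using inner_vertex_has_edge[OF inj v] by blast
    then obtain U where U: "infinitesimal_motion (delete_edge G e) p U"
      "\<forall>w\<in>inner_verts G. U $ w \<noteq> 0"
      using p by (auto simp: strong_configs_def)
    obtain q where q: "continuous_on {0..1} q" "q 0 = p"
      "\<And>t w. t \<in> {0..1} \<Longrightarrow> w \<notin> inner_verts G \<Longrightarrow> q t $ w = p $ w"
      "\<And>t r. t \<in> {0..1} \<Longrightarrow> r \<in> rig_rows (delete_edge G e) \<Longrightarrow>
        half_sq_length r (q t) = half_sq_length r p"
      "\<And>w. w \<in> inner_verts G \<Longrightarrow> U $ w \<noteq> 0 \<Longrightarrow> moves q w"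
      using edge_release_path[OF \<sigma> inj e(1) U(1)] by blast
    have "norm (q t $ a - q t $ b) = norm (p $ a - p $ b)"
      if t: "t \<in> {0..1}" and ab: "{a, b} \<in># edges (delete_vertex G v)" for t a b
    \<comment> \<open>\<open>finite_motion\<close> quantifies over all pairs; for equal vertices
      both norms are zero.\<close>
    proof (cases "a = b")
      case False
      have "{a, b} \<in># edges G" "{a, b} \<noteq> e"
        using ab e(2) by (auto simp: delete_vertex_def)
      \<comment> \<open>Edges that avoid \<open>v\<close> differ from \<open>e\<close>, so all their
        copies survive the deletion of \<open>e\<close>. Parallel copies impose the same length,
        hence copy 0 suffices.\<close>
      then have "({a, b}, 0) \<in> rig_rows (delete_edge G e)"
        unfolding rig_rows_delete_edge[OF e(1)] by (simp add: rig_rows_def)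
      then have "(norm (q t $ a - q t $ b))\<^sup>2 = (norm (p $ a - p $ b))\<^sup>2"
        using q(4)[OF t, of "({a, b}, 0)"] by (simp add: half_sq_length_edge[OF False])
      then show ?thesis
        by simp
    qed simp
    moreover have "q t $ k = p $ k" if "t \<in> {0..1}" "k \<in> pinned_verts (delete_vertex G v)" for t k
      using that q(3) assms(1) by (auto simp: wf_pinned_graph_def delete_vertex_def)
    ultimately have "finite_motion (delete_vertex G v) p q"
      using q(1,2) by (simp add: finite_motion_def)
    moreover have "\<forall>w\<in>inner_verts (delete_vertex G v). moves q w"
      using q(5) U(2) by (simp add: delete_vertex_def)
    ultimately show ?thesis by blast
  qed
  moreover have "open (strong_configs G :: (real ^ 'd ^ 'v) set)"
    unfolding F(2) by (rule open_polynomial_nonzero[OF F(1)])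
  moreover have "closure (strong_configs G :: (real ^ 'd ^ 'v) set) = UNIV"
    using ne dense_polynomial_nonzero[OF F(1)] unfolding F(2) by blast
  ultimately show ?thesis by blast
qed

end
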